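(* Let $\kappa$ be an uncountable regular cardinal and assume $\mathbb{B}$ is a $\kappa$-Corson Boolean algebra. Then every subalgebra of $\mathbb{B}$ is $\kappa$-Corson.
   Context: A Boolean algebra $\mathbb{B}$ is $\kappa$-Corson if there is a set $G \subseteq \mathbb{B}$ generating $\mathbb{B}$ as a Boolean algebra such that $|G \cap p| < \kappa$ for every ultrafilter $p$ of $\mathbb{B}$. *)

theory Defs
  imports Complex_Main
begin

unbundle cardinal_syntax

text \<open>
  A Boolean algebra is given by a carrier set \<open>B\<close> that is closed under the operations of a
  type of class \<open>boolean_algebra\<close>; the case \<open>B = UNIV\<close> is an arbitrary Boolean algebra.
  The trivial algebra (\<open>bot = top\<close>) is not excluded.
\<close>

definition subalgebra :: "'a::boolean_algebra set \<Rightarrow> bool" where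
  "subalgebra B \<longleftrightarrow>
     bot \<in> B \<and> top \<in> B \<and> (\<forall>x\<in>B. - x \<in> B) \<and>
     (\<forall>x\<in>B. \<forall>y\<in>B. inf x y \<in> B \<and> sup x y \<in> B)"

definition proper_filter :: "'a::boolean_algebra set \<Rightarrow> 'a set \<Rightarrow> bool" where
  "proper_filter B F \<longleftrightarrow>
     F \<subseteq> B \<and> top \<in> F \<and> bot \<notin> F \<and>
     (\<forall>x\<in>F. \<forall>y\<in>F. inf x y \<in> F) \<and>
     (\<forall>x\<in>F. \<forall>y\<in>B. x \<le> y \<longrightarrow> y \<in> F)"

definition ultrafilter :: "'a::boolean_algebra set \<Rightarrow> 'a set \<Rightarrow> bool" where
  "ultrafilter B p \<longleftrightarrow>
     proper_filter B p \<and> (\<forall>F. proper_filter B F \<and> p \<subseteq> F \<longrightarrow> F = p)"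

text \<open>
  The hull is taken among the subalgebras of the ambient type. When \<open>B\<close> is a subalgebra and
  \<open>G \<subseteq> B\<close>, it coincides with the subalgebra of \<open>B\<close> generated by \<open>G\<close>.
\<close>

definition Corson :: "'k rel \<Rightarrow> 'a::boolean_algebra set \<Rightarrow> bool" where
  "Corson \<kappa> B \<longleftrightarrow>
     subalgebra B \<and>
     (\<exists>G. G \<subseteq> B \<and> subalgebra hull G = B \<and>
          (\<forall>p. ultrafilter B p \<longrightarrow> |G \<inter> p| <o \<kappa>))"

end

theory Submission
  imports Defs
begin

text \<open>
  Call a subset \<open>M\<close> of \<open>B\<close> elementary if it is closed under the operations and under a choice of
  witnesses, a set of fewer than \<open>\<kappa>\<close> generators for each element. The witnesses ensure that \<open>B\<close>
  retracts onto \<open>M\<close> by sending the generators outside \<open>M\<close> to \<open>bot\<close>, and that this retraction maps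
  \<open>A\<close> into \<open>A \<inter> M\<close>. Since \<open>\<kappa>\<close> is regular and uncountable, closing off a set of size less than \<open>\<mu>\<close>,
  where \<open>\<kappa> \<le> \<mu>\<close>, yields an elementary set of size less than \<open>\<mu>\<close>. By induction on \<open>|M|\<close>, each
  \<open>A \<inter> M\<close> has a suitable generating set: write \<open>M\<close> as the union of a continuous chain of smaller
  elementary sets \<open>M\<^sub>g\<close>, and replace each generator \<open>h\<close> of \<open>A \<inter> M\<^sub>g\<^sub>+\<^sub>1\<close> by its differences, in
  both directions, from its retract in \<open>M\<^sub>g\<close>. A point sees fewer than \<open>\<kappa>\<close> elements from each step of
  the chain, and none at all unless one of the generators it contains lies in \<open>M\<^sub>g\<^sub>+\<^sub>1 - M\<^sub>g\<close>.
\<close>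

section \<open>Subalgebras and ultrafilters\<close>

lemma subalgebra_bot: "subalgebra B \<Longrightarrow> bot \<in> B"
  and subalgebra_top: "subalgebra B \<Longrightarrow> top \<in> B"
  and subalgebra_uminus: "subalgebra B \<Longrightarrow> x \<in> B \<Longrightarrow> - x \<in> B"
  and subalgebra_inf: "subalgebra B \<Longrightarrow> x \<in> B \<Longrightarrow> y \<in> B \<Longrightarrow> inf x y \<in> B"
  and subalgebra_sup: "subalgebra B \<Longrightarrow> x \<in> B \<Longrightarrow> y \<in> B \<Longrightarrow> sup x y \<in> B"
  by (auto simp: subalgebra_def)

lemma subalgebraI:
  assumes "bot \<in> B" and "\<And>x. x \<in> B \<Longrightarrow> - x \<in> B"
    and "\<And>x y. x \<in> B \<Longrightarrow> y \<in> B \<Longrightarrow> inf x y \<in> B"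
  shows "subalgebra B"
proof -
  have "sup x y \<in> B" if "x \<in> B" "y \<in> B" for x y
    using assms(2)[OF assms(3)[OF assms(2)[OF that(1)] assms(2)[OF that(2)]]] by simp
  moreover have "top \<in> B"
    using assms(2)[OF assms(1)] by simp
  ultimately show ?thesis
    using assms by (auto simp: subalgebra_def)
qed

lemma subalgebra_hull: "subalgebra (subalgebra hull G)"
  by (rule hull_in) (auto simp: subalgebra_def)

text \<open>The elements of \<open>B\<close> above some member of \<open>X\<close> form a proper
  filter, and Zorn's lemma extends it to a maximal one.\<close>

lemma ultrafilter_extend:
  assumes B: "subalgebra B" and X: "X \<subseteq> B" "X \<noteq> {}" "bot \<notin> X"
    and inf: "\<And>x y. x \<in> X \<Longrightarrow> y \<in> X \<Longrightarrow> inf x y \<in> X"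
  shows "\<exists>p. ultrafilter B p \<and> X \<subseteq> p"
proof -
  define F where "F = {y \<in> B. \<exists>x\<in>X. x \<le> y}"
  have "proper_filter B F"
    unfolding proper_filter_def
  proof (intro conjI ballI impI)
    show "top \<in> F"
      using X subalgebra_top[OF B] by (auto simp: F_def)
    show "bot \<notin> F"
      using X by (auto simp: F_def bot_unique)
    show "inf x y \<in> F" if xy: "x \<in> F" "y \<in> F" for x y
    proof -
      obtain u v where "u \<in> X" "v \<in> X" "u \<le> x" "v \<le> y" "x \<in> B" "y \<in> B"
        using xy unfolding F_def by blast
      then show ?thesis
        using inf[of u v] subalgebra_inf[OF B] inf_mono by (fastforce simp: F_def)
    qed
    show "y \<in> F" if "x \<in> F" "y \<in> B" "x \<le> y" for x y
      using that order_trans by (fastforce simp: F_def)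
  qed (auto simp: F_def)
  moreover have "X \<subseteq> F"
    using X by (auto simp: F_def)
  define \<F> where "\<F> = {E. proper_filter B E \<and> F \<subseteq> E}"
  ultimately have ne: "\<F> \<noteq> {}"
    by (auto simp: \<F>_def)
  have "\<exists>M\<in>\<F>. \<forall>E\<in>\<F>. M \<subseteq> E \<longrightarrow> E = M"
  proof (rule subset_Zorn_nonempty[OF ne])
    fix C assume "C \<noteq> {}" and C: "subset.chain \<F> C"
    have pf: "proper_filter B E" "F \<subseteq> E" if "E \<in> C" for E
      using C that by (auto simp: \<F>_def subset.chain_def)
    have "proper_filter B (\<Union>C)"
      unfolding proper_filter_def
    proof (intro conjI ballI impI)
      show "\<Union>C \<subseteq> B"
        using pf(1) by (intro Union_least) (simp add: proper_filter_def)
      show "bot \<notin> \<Union>C"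
        using pf(1) by (auto simp: proper_filter_def)
      show "top \<in> \<Union>C"
        using pf(1) \<open>C \<noteq> {}\<close> by (auto simp: proper_filter_def)
      show "inf x y \<in> \<Union>C" if xy: "x \<in> \<Union>C" "y \<in> \<Union>C" for x y
      proof -
        obtain E E' where E: "E \<in> C" "x \<in> E" "E' \<in> C" "y \<in> E'"
          using xy by auto
        then have "E \<subseteq> E' \<or> E' \<subseteq> E"
          using C unfolding subset_chain_def by blast
        with E obtain D where D: "D \<in> C" "x \<in> D" "y \<in> D"
          by blast
        then have "inf x y \<in> D"
          using pf(1)[OF D(1)] by (simp add: proper_filter_def)
        then show ?thesis
          using D(1) by blast
      qed
      show "y \<in> \<Union>C" if xy: "x \<in> \<Union>C" "y \<in> B" "x \<le> y" for x y
      proof -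
        obtain E where E: "E \<in> C" "x \<in> E"
          using xy(1) by auto
        then have "y \<in> E"
          using pf(1)[OF E(1)] xy(2,3) by (simp add: proper_filter_def)
        then show ?thesis
          using E(1) by blast
      qed
    qed
    moreover have "F \<subseteq> \<Union>C"
      using pf(2) \<open>C \<noteq> {}\<close> by blast
    ultimately show "\<Union>C \<in> \<F>"
      by (simp add: \<F>_def)
  qed
  then obtain p where p: "p \<in> \<F>" and max: "\<And>E. E \<in> \<F> \<Longrightarrow> p \<subseteq> E \<Longrightarrow> E = p"
    by blast
  have "ultrafilter B p"
    unfolding ultrafilter_def
  proof (intro conjI allI impI)
    show "proper_filter B p"
      using p by (simp add: \<F>_def)
    show "E = p" if "proper_filter B E \<and> p \<subseteq> E" for E
      using that p max[of E] by (auto simp: \<F>_def)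
  qed
  then show ?thesis
    using p \<open>X \<subseteq> F\<close> by (auto simp: \<F>_def)
qed

lemma ultrafilter_subset: "ultrafilter B p \<Longrightarrow> p \<subseteq> B"
  and ultrafilter_top: "ultrafilter B p \<Longrightarrow> top \<in> p"
  and ultrafilter_bot: "ultrafilter B p \<Longrightarrow> bot \<notin> p"
  and ultrafilter_infI: "ultrafilter B p \<Longrightarrow> x \<in> p \<Longrightarrow> y \<in> p \<Longrightarrow> inf x y \<in> p"
  and ultrafilter_mono: "ultrafilter B p \<Longrightarrow> x \<in> p \<Longrightarrow> y \<in> B \<Longrightarrow> x \<le> y \<Longrightarrow> y \<in> p"
  by (auto simp: ultrafilter_def proper_filter_def)

lemma ultrafilter_maximal:
  "ultrafilter B p \<Longrightarrow> ultrafilter B q \<Longrightarrow> p \<subseteq> q \<Longrightarrow> q = p"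
  by (auto simp: ultrafilter_def)

lemma ultrafilter_inf_iff:
  assumes "ultrafilter B p" "x \<in> B" "y \<in> B"
  shows "inf x y \<in> p \<longleftrightarrow> x \<in> p \<and> y \<in> p"
  using ultrafilter_infI[OF assms(1)] ultrafilter_mono[OF assms(1)] assms(2,3)
  by (meson inf.cobounded1 inf.cobounded2)

text \<open>If \<open>p\<close> contained neither \<open>x\<close> nor \<open>- x\<close>, no
  \<open>a \<in> p\<close> would be disjoint from \<open>x\<close>, as then
  \<open>a \<le> - x\<close>. The meets \<open>inf a x\<close> would extend to an ultrafilter
  strictly larger than \<open>p\<close>.\<close>

lemma ultrafilter_uminus_iff:
  assumes B: "subalgebra B" and p: "ultrafilter B p" and x: "x \<in> B"
  shows "- x \<in> p \<longleftrightarrow> x \<notin> p"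
proof
  assume "- x \<in> p"
  then show "x \<notin> p"
    using ultrafilter_infI[OF p, of x "- x"] ultrafilter_bot[OF p] by auto
next
  assume "x \<notin> p"
  show "- x \<in> p"
  proof (rule ccontr)
    assume n: "- x \<notin> p"
    let ?X = "(\<lambda>a. inf a x) ` p"
    have "\<exists>q. ultrafilter B q \<and> ?X \<subseteq> q"
    proof (rule ultrafilter_extend[OF B])
      show "?X \<subseteq> B"
        using ultrafilter_subset[OF p] x subalgebra_inf[OF B] by auto
      show "?X \<noteq> {}"
        using ultrafilter_top[OF p] by auto
      show "bot \<notin> ?X"
      proof
        assume "bot \<in> ?X"
        then obtain a where "a \<in> p" "inf a x = bot"
          by auto
        then have "a \<le> - x"
          by (simp add: inf_shunt)
        then show False
          using n \<open>a \<in> p\<close> ultrafilter_mono[OF p] subalgebra_uminus[OF B x] by blast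
      qed
      show "inf u v \<in> ?X" if uv: "u \<in> ?X" "v \<in> ?X" for u v
      proof -
        obtain a b where "a \<in> p" "b \<in> p" "u = inf a x" "v = inf b x"
          using uv by auto
        then show ?thesis
          using ultrafilter_infI[OF p, of a b]
          by (simp add: image_iff) (rule bexI[of _ "inf a b"], simp_all add: inf_aci)
      qed
    qed
    then obtain q where q: "ultrafilter B q" and X: "?X \<subseteq> q"
      by blast
    have "p \<subseteq> q"
    proof
      fix a assume "a \<in> p"
      then have "inf a x \<in> q" "a \<in> B"
        using X ultrafilter_subset[OF p] by auto
      then show "a \<in> q"
        by (rule ultrafilter_mono[OF q]) simp
    qed
    then have "q = p"
      by (rule ultrafilter_maximal[OF p q])
    moreover have "x \<in> q"
      using X ultrafilter_top[OF p] by force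
    ultimately show False
      using \<open>x \<notin> p\<close> by simp
  qed
qed

text \<open>The elements of \<open>B\<close> on which two ultrafilters agree form a subalgebra. An
  ultrafilter is thus determined by its trace on a generating set.\<close>

lemma ultrafilters_agree_hull:
  assumes B: "subalgebra B" and p: "ultrafilter B p" and q: "ultrafilter B q"
    and X: "X \<subseteq> B" "\<And>x. x \<in> X \<Longrightarrow> x \<in> p \<longleftrightarrow> x \<in> q" and a: "a \<in> subalgebra hull X"
  shows "a \<in> p \<longleftrightarrow> a \<in> q"
proof -
  have "a \<in> B \<and> (a \<in> p \<longleftrightarrow> a \<in> q)"
  proof (rule hull_induct[OF a])
    show "subalgebra {a. a \<in> B \<and> (a \<in> p \<longleftrightarrow> a \<in> q)}"
      using B p q
      by (intro subalgebraI)
        (auto simp: ultrafilter_uminus_iff ultrafilter_inf_iff subalgebra_bot subalgebra_uminus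
          subalgebra_inf ultrafilter_bot)
  qed (use X in auto)
  then show ?thesis
    by simp
qed

text \<open>The meets \<open>inf a b\<close> with \<open>a \<in> p\<close> extend to an ultrafilter
  \<open>w\<close>. Its trace on \<open>A\<close> cannot exceed \<open>p\<close>, since
  \<open>p\<close> contains \<open>a\<close> or \<open>- a\<close> for each
  \<open>a \<in> A\<close>.\<close>

lemma ultrafilter_over:
  assumes A: "subalgebra A" and B: "subalgebra B" and AB: "A \<subseteq> B" and p: "ultrafilter A p"
    and b: "b \<in> B" "\<And>a. a \<in> p \<Longrightarrow> inf a b \<noteq> bot"
  shows "\<exists>w. ultrafilter B w \<and> w \<inter> A = p \<and> b \<in> w"
proof -
  have pB: "p \<subseteq> B"
    using ultrafilter_subset[OF p] AB by blast
  have "\<exists>w. ultrafilter B w \<and> (\<lambda>a. inf a b) ` p \<subseteq> w"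
  proof (rule ultrafilter_extend[OF B])
    show "(\<lambda>a. inf a b) ` p \<subseteq> B"
      using subalgebra_inf[OF B] pB b by auto
    show "(\<lambda>a. inf a b) ` p \<noteq> {}"
      using ultrafilter_top[OF p] by auto
    show "bot \<notin> (\<lambda>a. inf a b) ` p"
      using b by force
    show "inf u v \<in> (\<lambda>a. inf a b) ` p" if uv: "u \<in> (\<lambda>a. inf a b) ` p" "v \<in> (\<lambda>a. inf a b) ` p" for u v
    proof -
      obtain c d where "c \<in> p" "d \<in> p" "u = inf c b" "v = inf d b"
        using uv by auto
      then show ?thesis
        using ultrafilter_infI[OF p, of c d]
        by (simp add: image_iff) (rule bexI[of _ "inf c d"], simp_all add: inf_aci)
    qed
  qed
  then obtain w where w: "ultrafilter B w" and X: "(\<lambda>a. inf a b) ` p \<subseteq> w"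
    by blast
  have "p \<subseteq> w"
  proof
    fix a assume "a \<in> p"
    then have "inf a b \<in> w" "a \<in> B"
      using X pB by auto
    then show "a \<in> w"
      by (rule ultrafilter_mono[OF w]) simp
  qed
  moreover have "a \<in> p" if "a \<in> w" "a \<in> A" for a
    using that ultrafilter_uminus_iff[OF A p, of a] ultrafilter_uminus_iff[OF B w, of a] AB
      \<open>p \<subseteq> w\<close> by blast
  moreover have "b \<in> w"
    using X ultrafilter_top[OF p] by force
  ultimately show ?thesis
    using w ultrafilter_subset[OF p] by blast
qed

text \<open>As \<open>b\<close> is outside \<open>A\<close>, some ultrafilter of \<open>A\<close>
  contains no element below \<open>b\<close> and none below \<open>- b\<close>. It extends to
  \<open>B\<close> both with \<open>b\<close> and with \<open>- b\<close>.\<close>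

lemma ultrafilters_separate:
  assumes A: "subalgebra A" and B: "subalgebra B" and AB: "A \<subseteq> B" and b: "b \<in> B" "b \<notin> A"
  shows "\<exists>w w'. ultrafilter B w \<and> ultrafilter B w' \<and> w \<inter> A = w' \<inter> A \<and> b \<in> w \<and> b \<notin> w'"
proof -
  \<comment> \<open>The dual filter of the ideal of \<open>A\<close> generated by the elements below \<open>b\<close> or below \<open>- b\<close>.\<close>
  define X where "X = {inf (- c) (- d) | c d. c \<in> A \<and> d \<in> A \<and> c \<le> b \<and> d \<le> - b}"
  have "\<exists>p. ultrafilter A p \<and> X \<subseteq> p"
  proof (rule ultrafilter_extend[OF A])
    show "X \<subseteq> A"
      using A by (auto simp: X_def subalgebra_inf subalgebra_uminus)
    show "X \<noteq> {}"
      using subalgebra_bot[OF A] bot_least unfolding X_def by blast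
    show "bot \<notin> X"
    proof
      assume "bot \<in> X"
      then obtain c d where cd: "c \<in> A" "c \<le> b" "d \<le> - b" "inf (- c) (- d) = bot"
        by (auto simp: X_def)
      \<comment> \<open>If \<open>c\<close> and \<open>d\<close> join to \<open>top\<close>, then
        \<open>b \<le> c\<close>, hence \<open>b = c\<close>, although \<open>b\<close> is not in
        \<open>A\<close>.\<close>
      have "- c \<le> d"
        using cd(4) by (simp add: inf_shunt)
      then have "- c \<le> - b"
        using cd(3) by (rule order_trans)
      then have "c = b"
        using cd(2) by simp
      then show False
        using cd(1) b by simp
    qed
    show "inf u v \<in> X" if uv: "u \<in> X" "v \<in> X" for u v
    proof -
      obtain c d c' d' where cd: "u = inf (- c) (- d)" "c \<in> A" "d \<in> A" "c \<le> b" "d \<le> - b"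
        "v = inf (- c') (- d')" "c' \<in> A" "d' \<in> A" "c' \<le> b" "d' \<le> - b"
        using uv by (auto simp: X_def)
      have "inf u v = inf (- (sup c c')) (- (sup d d'))"
        by (simp add: cd inf_aci)
      moreover have "sup c c' \<in> A" "sup d d' \<in> A" "sup c c' \<le> b" "sup d d' \<le> - b"
        using cd subalgebra_sup[OF A] by auto
      ultimately show ?thesis
        unfolding X_def by blast
    qed
  qed
  then obtain p where p: "ultrafilter A p" and X: "X \<subseteq> p"
    by blast
  have 1: "a \<notin> p" if "a \<in> A" "a \<le> b \<or> a \<le> - b" for a
  proof -
    have "inf (- a) (- bot) \<in> X \<or> inf (- bot) (- a) \<in> X"
      using that subalgebra_bot[OF A] bot_least unfolding X_def by blast
    then have "- a \<in> p"
      using X by auto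
    then show ?thesis
      using ultrafilter_uminus_iff[OF A p that(1)] by simp
  qed
  have "inf a b \<noteq> bot" "inf a (- b) \<noteq> bot" if "a \<in> p" for a
    using 1[of a] that ultrafilter_subset[OF p] by (auto simp: inf_shunt)
  then obtain w w' where "ultrafilter B w" "w \<inter> A = p" "b \<in> w"
    "ultrafilter B w'" "w' \<inter> A = p" "- b \<in> w'"
    using ultrafilter_over[OF A B AB p b(1)]
      ultrafilter_over[OF A B AB p subalgebra_uminus[OF B b(1)]] by blast
  then show ?thesis
    using ultrafilter_uminus_iff[OF B _ b(1)] by blast
qed

text \<open>The elements generated by finite subsets of \<open>G\<close> form a subalgebra that
  contains \<open>G\<close>.\<close>

lemma hull_finitely_generated:
  assumes "b \<in> subalgebra hull G"
  shows "\<exists>F. finite F \<and> F \<subseteq> G \<and> b \<in> subalgebra hull F"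
proof (rule hull_induct[OF assms])
  show "\<exists>F. finite F \<and> F \<subseteq> G \<and> x \<in> subalgebra hull F" if "x \<in> G" for x
    using that by (intro exI[of _ "{x}"]) (auto intro: hull_inc)
  show "subalgebra {x. \<exists>F. finite F \<and> F \<subseteq> G \<and> x \<in> subalgebra hull F}"
  proof (rule subalgebraI; clarsimp)
    show "\<exists>F. finite F \<and> F \<subseteq> G \<and> bot \<in> subalgebra hull F"
      using subalgebra_bot[OF subalgebra_hull] by blast
    show "\<exists>F'. finite F' \<and> F' \<subseteq> G \<and> - x \<in> subalgebra hull F'"
      if "finite F" "F \<subseteq> G" "x \<in> subalgebra hull F" for x F
      using that subalgebra_uminus[OF subalgebra_hull] by blast
    show "\<exists>E. finite E \<and> E \<subseteq> G \<and> inf x y \<in> subalgebra hull E"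
      if "finite F" "F \<subseteq> G" "x \<in> subalgebra hull F"
        "finite F'" "F' \<subseteq> G" "y \<in> subalgebra hull F'" for x y F F'
    proof (intro exI[of _ "F \<union> F'"] conjI)
      have "x \<in> subalgebra hull (F \<union> F')" "y \<in> subalgebra hull (F \<union> F')"
        using that hull_mono[of F "F \<union> F'" subalgebra] hull_mono[of F' "F \<union> F'" subalgebra] by auto
      then show "inf x y \<in> subalgebra hull (F \<union> F')"
        by (rule subalgebra_inf[OF subalgebra_hull])
    qed (use that in auto)
  qed
qed

section \<open>Closing off under a small-valued operation\<close>

text \<open>Because \<open>x \<in> D x y\<close>, the iterates increase. Two elements of their union
  therefore lie in a common iterate, and the value of \<open>D\<close> at them in the next
  one.\<close>

lemma funpow_Union_closed:
  fixes D :: "'a \<Rightarrow> 'a \<Rightarrow> 'a set"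
  assumes "\<And>x y. x \<in> D x y"
  defines "step \<equiv> \<lambda>X. \<Union>x\<in>X. \<Union>y\<in>X. D x y"
  shows "(\<lambda>M. \<forall>x\<in>M. \<forall>y\<in>M. D x y \<subseteq> M) hull X \<subseteq> (\<Union>n. (step ^^ n) X)"
proof (rule hull_minimal)
  show "X \<subseteq> (\<Union>n. (step ^^ n) X)"
    using UN_upper[of 0 UNIV "\<lambda>n. (step ^^ n) X"] by simp
  have "mono (\<lambda>n. (step ^^ n) X)"
    using assms(1) by (intro mono_iff_le_Suc[THEN iffD2]) (auto simp: step_def)
  then have mono: "(step ^^ n) X \<subseteq> (step ^^ m) X" if "n \<le> m" for n m
    using that by (rule monoD)
  show "\<forall>x\<in>\<Union>n. (step ^^ n) X. \<forall>y\<in>\<Union>n. (step ^^ n) X. D x y \<subseteq> (\<Union>n. (step ^^ n) X)"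
  proof clarify
    fix x y z n m assume "x \<in> (step ^^ n) X" "y \<in> (step ^^ m) X" and z: "z \<in> D x y"
    then have "x \<in> (step ^^ max n m) X" "y \<in> (step ^^ max n m) X"
      using mono[of n "max n m"] mono[of m "max n m"] by auto
    with z have "z \<in> (step ^^ Suc (max n m)) X"
      by (auto simp: step_def)
    then show "z \<in> (\<Union>n. (step ^^ n) X)"
      by blast
  qed
qed

text \<open>Stability keeps each iterate smaller than \<open>\<kappa>\<close> and, as
  \<open>\<kappa>\<close> is uncountable, also the union of all of them.\<close>

lemma card_of_closure_small:
  fixes D :: "'a \<Rightarrow> 'a \<Rightarrow> 'a set" and \<kappa> :: "'k rel"
  assumes \<kappa>: "natLeq <o \<kappa>" "stable \<kappa>"
    and D: "\<And>x y. x \<in> D x y" "\<And>x y. |D x y| <o \<kappa>" and X: "|X| <o \<kappa>"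
  shows "|(\<lambda>M. \<forall>x\<in>M. \<forall>y\<in>M. D x y \<subseteq> M) hull X| <o \<kappa>"
proof -
  let ?step = "\<lambda>X. \<Union>x\<in>X. \<Union>y\<in>X. D x y"
  have "|(?step ^^ n) X| <o \<kappa>" for n
    by (induction n) (auto intro!: X D(2) stable_UNION[OF \<kappa>(2)])
  moreover have "|UNIV :: nat set| <o \<kappa>"
    using card_of_nat \<kappa>(1) by (rule ordIso_ordLess_trans)
  ultimately have "|\<Union>n. (?step ^^ n) X| <o \<kappa>"
    by (intro stable_UNION[OF \<kappa>(2)])
  then show ?thesis
    using card_of_mono1[OF funpow_Union_closed[OF D(1)]] by (rule ordLeq_ordLess_trans[rotated])
qed

text \<open>A union of at most \<open>|X|\<close> sets of size at most \<open>|X|\<close> again has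
  size at most \<open>|X|\<close>. This serves for sizes from \<open>\<kappa>\<close> on, singular
  ones included.\<close>

lemma card_of_closure_large:
  fixes D :: "'a \<Rightarrow> 'a \<Rightarrow> 'a set"
  assumes D: "\<And>x y. x \<in> D x y" "\<And>x y. |D x y| \<le>o |X|" and X: "infinite X"
  shows "|(\<lambda>M. \<forall>x\<in>M. \<forall>y\<in>M. D x y \<subseteq> M) hull X| \<le>o |X|"
proof -
  let ?step = "\<lambda>X. \<Union>x\<in>X. \<Union>y\<in>X. D x y"
  have "|(?step ^^ n) X| \<le>o |X|" for n
    by (induction n) (auto intro!: D(2) card_of_UNION_ordLeq_infinite[OF X] ordLeq_refl card_of_Card_order)
  moreover have "|UNIV :: nat set| \<le>o |X|"
    using X by (simp add: infinite_iff_card_of_nat)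
  ultimately have "|\<Union>n. (?step ^^ n) X| \<le>o |X|"
    by (intro card_of_UNION_ordLeq_infinite[OF X]) auto
  then show ?thesis
    using card_of_mono1[OF funpow_Union_closed[OF D(1)]] by (rule ordLeq_transitive[rotated])
qed

section \<open>Elementary subsets\<close>

locale corson_subalgebra =
  fixes \<kappa> :: "'k rel" and A B G :: "'a::boolean_algebra set"
  assumes card_order: "Card_order \<kappa>" and uncountable: "natLeq <o \<kappa>"
    and regular: "regularCard \<kappa>"
    and subalgebra_A: "subalgebra A" and subalgebra_B: "subalgebra B" and A_subset_B: "A \<subseteq> B"
    and G_subset_B: "G \<subseteq> B" and hull_G: "subalgebra hull G = B"
    and point_small: "\<And>p. ultrafilter B p \<Longrightarrow> |G \<inter> p| <o \<kappa>"
begin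

section \<open>Cardinal arithmetic below \<open>\<kappa>\<close>\<close>

lemma infinite_Field: "infinite (Field \<kappa>)"
proof -
  have "natLeq \<le>o |Field \<kappa>|"
    using ordLess_imp_ordLeq[OF uncountable] ordIso_symmetric[OF card_of_Field_ordIso[OF card_order]]
    by (rule ordLeq_ordIso_trans)
  then show ?thesis
    using infinite_iff_natLeq_ordLeq by blast
qed

lemma stable: "stable \<kappa>"
  by (rule regularCard_stable[OF card_order infinite_Field regular])

lemma finite_small: "finite X \<Longrightarrow> |X| <o \<kappa>"
  by (rule ordLess_transitive[OF _ uncountable]) (simp add: finite_iff_ordLess_natLeq[symmetric])

lemma Un_small: "|X| <o \<kappa> \<Longrightarrow> |Y| <o \<kappa> \<Longrightarrow> |X \<union> Y| <o \<kappa>"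
  by (rule card_of_Un_ordLess_infinite_Field[OF infinite_Field card_order])

lemma subset_small: "|Y| <o \<kappa> \<Longrightarrow> X \<subseteq> Y \<Longrightarrow> |X| <o \<kappa>"
  by (rule ordLeq_ordLess_trans[OF card_of_mono1])

lemma image_small: "|X| <o \<kappa> \<Longrightarrow> |f ` X| <o \<kappa>"
  by (rule ordLeq_ordLess_trans[OF card_of_image])

lemma small_or_large: "|X| <o \<kappa> \<or> \<kappa> \<le>o |X|"
proof -
  have "Well_order \<kappa>"
    by (rule card_order_on_well_order_on[OF card_order])
  then show ?thesis
    using not_ordLess_iff_ordLeq[OF _ card_of_Well_order, of \<kappa> X] by blast
qed

text \<open>Call \<open>G \<inter> p\<close> the support of a point \<open>p\<close>. If
  \<open>M\<close> contains a witness for each of its elements, the first line makes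
  \<open>G \<inter> M\<close> generate \<open>M\<close>, the second provides each nonzero element of
  \<open>M\<close> with a point supported in \<open>M\<close>, and the third forces the retracts of
  elements of \<open>A\<close> to lie in \<open>A\<close>.\<close>

definition witness :: "'a \<Rightarrow> 'a set \<Rightarrow> bool" where
  "witness b T \<longleftrightarrow> T \<subseteq> G \<and> b \<in> subalgebra hull T \<and>
     (b \<noteq> bot \<longrightarrow> (\<exists>u. ultrafilter B u \<and> b \<in> u \<and> G \<inter> u \<subseteq> T)) \<and>
     (b \<notin> A \<longrightarrow> (\<exists>w w'. ultrafilter B w \<and> ultrafilter B w' \<and> w \<inter> A = w' \<inter> A \<and> b \<in> w \<and> b \<notin> w' \<and>
        G \<inter> w \<subseteq> T \<and> G \<inter> w' \<subseteq> T))"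

text \<open>The union of a finite set generating \<open>b\<close>, the support of one point
  containing \<open>b\<close> and the supports of two points separated by \<open>b\<close> is a
  witness. Supports are small by the choice of \<open>G\<close>.\<close>

lemma small_witness_exists:
  assumes b: "b \<in> B"
  shows "\<exists>T. witness b T \<and> |T| <o \<kappa>"
proof -
  obtain F where F: "finite F" "F \<subseteq> G" "b \<in> subalgebra hull F"
    using hull_finitely_generated b hull_G by blast
  have "\<exists>T1. T1 \<subseteq> G \<and> |T1| <o \<kappa> \<and> (b \<noteq> bot \<longrightarrow> (\<exists>u. ultrafilter B u \<and> b \<in> u \<and> G \<inter> u \<subseteq> T1))"
  proof (cases "b = bot")
    case True
    then show ?thesis
      using finite_small[of "{}"] by (intro exI[of _ "{}"]) simp
  next
    case False
    then obtain u where "ultrafilter B u" "b \<in> u"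
      using ultrafilter_extend[OF subalgebra_B, of "{b}"] b by auto
    then show ?thesis
      using point_small[of u] by (intro exI[of _ "G \<inter> u"]) auto
  qed
  then obtain T1 where T1: "T1 \<subseteq> G" "|T1| <o \<kappa>"
    "b \<noteq> bot \<longrightarrow> (\<exists>u. ultrafilter B u \<and> b \<in> u \<and> G \<inter> u \<subseteq> T1)"
    by blast
  have "\<exists>T2. T2 \<subseteq> G \<and> |T2| <o \<kappa> \<and> (b \<notin> A \<longrightarrow> (\<exists>w w'. ultrafilter B w \<and> ultrafilter B w' \<and>
    w \<inter> A = w' \<inter> A \<and> b \<in> w \<and> b \<notin> w' \<and> G \<inter> w \<subseteq> T2 \<and> G \<inter> w' \<subseteq> T2))"
  proof (cases "b \<in> A")
    case True
    then show ?thesis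
      using finite_small[of "{}"] by (intro exI[of _ "{}"]) simp
  next
    case False
    then obtain w w' where w: "ultrafilter B w" "ultrafilter B w'" "w \<inter> A = w' \<inter> A" "b \<in> w" "b \<notin> w'"
      using ultrafilters_separate[OF subalgebra_A subalgebra_B A_subset_B b] by blast
    then show ?thesis
      using Un_small[OF point_small point_small, of w w']
      by (intro exI[of _ "G \<inter> w \<union> G \<inter> w'"]) blast
  qed
  then obtain T2 where T2: "T2 \<subseteq> G" "|T2| <o \<kappa>" "b \<notin> A \<longrightarrow> (\<exists>w w'. ultrafilter B w \<and>
    ultrafilter B w' \<and> w \<inter> A = w' \<inter> A \<and> b \<in> w \<and> b \<notin> w' \<and> G \<inter> w \<subseteq> T2 \<and> G \<inter> w' \<subseteq> T2)"
    by blast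
  have "b \<in> subalgebra hull (F \<union> T1 \<union> T2)"
    using F(3) hull_mono[of F "F \<union> T1 \<union> T2" subalgebra] by blast
  moreover have "\<exists>u. ultrafilter B u \<and> b \<in> u \<and> G \<inter> u \<subseteq> F \<union> T1 \<union> T2" if "b \<noteq> bot"
    using T1(3)[rule_format, OF that] by fast
  moreover have "\<exists>w w'. ultrafilter B w \<and> ultrafilter B w' \<and> w \<inter> A = w' \<inter> A \<and> b \<in> w \<and> b \<notin> w' \<and>
      G \<inter> w \<subseteq> F \<union> T1 \<union> T2 \<and> G \<inter> w' \<subseteq> F \<union> T1 \<union> T2" if "b \<notin> A"
    using T2(3)[rule_format, OF that] by fast
  ultimately have "witness b (F \<union> T1 \<union> T2)"
    using F(2) T1(1) T2(1) unfolding witness_def by (intro conjI impI Un_least)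
  moreover have "|F \<union> T1 \<union> T2| <o \<kappa>"
    by (intro Un_small finite_small F T1 T2)
  ultimately show ?thesis
    by blast
qed

text \<open>The value \<open>{}\<close> outside \<open>B\<close> makes the size bound and the
  inclusion in \<open>G\<close> hold for every argument.\<close>

definition wit :: "'a \<Rightarrow> 'a set" where
  "wit b = (if b \<in> B then SOME T. witness b T \<and> |T| <o \<kappa> else {})"

lemma witness_wit: "b \<in> B \<Longrightarrow> witness b (wit b)"
  and wit_small: "|wit b| <o \<kappa>"
  and wit_subset_G: "wit b \<subseteq> G"
proof -
  have *: "witness b (wit b) \<and> |wit b| <o \<kappa>" if "b \<in> B" for b
    using someI_ex[OF small_witness_exists[OF that]] that by (simp add: wit_def)
  show "b \<in> B \<Longrightarrow> witness b (wit b)"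
    using * by blast
  show "|wit b| <o \<kappa>"
    using *[of b] finite_small[of "{}"] by (cases "b \<in> B") (auto simp: wit_def)
  show "wit b \<subseteq> G"
    using *[of b] by (cases "b \<in> B") (auto simp: witness_def wit_def)
qed

text \<open>The element \<open>x\<close> is included so that iteration is increasing. The set
  \<open>wit y\<close> enters when the arguments are exchanged.\<close>

definition step :: "'a \<Rightarrow> 'a \<Rightarrow> 'a set" where
  "step x y = {x, - x, inf x y} \<union> wit x"

text \<open>These sets play the role of the traces on \<open>B\<close> of the elementary submodels that contain
  \<open>\<kappa>\<close>, \<open>A\<close>, \<open>B\<close>, \<open>G\<close> and meet \<open>\<kappa>\<close> in an initial segment.\<close>

definition elementary :: "'a set \<Rightarrow> bool" where
  "elementary M \<longleftrightarrow> bot \<in> M \<and> (\<forall>x\<in>M. \<forall>y\<in>M. step x y \<subseteq> M)"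

lemma step_small: "|step x y| <o \<kappa>"
  unfolding step_def by (intro Un_small finite_small wit_small) auto

lemma elementary_wit: "elementary M \<Longrightarrow> b \<in> M \<Longrightarrow> wit b \<subseteq> M"
  unfolding elementary_def step_def by blast

lemma elementary_subalgebra: "elementary M \<Longrightarrow> subalgebra M"
  by (rule subalgebraI) (auto simp: elementary_def step_def)

lemma elementary_B: "elementary B"
  using subalgebra_B wit_subset_G G_subset_B
  by (fastforce simp: elementary_def step_def subalgebra_bot subalgebra_uminus subalgebra_inf)

lemma elementary_hull: "elementary (elementary hull X)"
proof (rule hull_in)
  show "elementary (\<Inter>\<C>)" if "Ball \<C> elementary" for \<C>
    using that unfolding elementary_def by blast
qed

lemma elementary_Union_chain:
  assumes "\<C> \<noteq> {}" and "\<And>M. M \<in> \<C> \<Longrightarrow> elementary M"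
    and "\<And>M N. M \<in> \<C> \<Longrightarrow> N \<in> \<C> \<Longrightarrow> M \<subseteq> N \<or> N \<subseteq> M"
  shows "elementary (\<Union>\<C>)"
  unfolding elementary_def
proof (intro conjI ballI)
  show "bot \<in> \<Union>\<C>"
    using assms(1,2) by (auto simp: elementary_def)
  show "step x y \<subseteq> \<Union>\<C>" if xy: "x \<in> \<Union>\<C>" "y \<in> \<Union>\<C>" for x y
  proof -
    obtain M where "M \<in> \<C>" "x \<in> M" "y \<in> M"
      using xy assms(3) by blast
    then show ?thesis
      using assms(2)[of M] by (auto simp: elementary_def)
  qed
qed

lemma elementary_generated:
  assumes M: "elementary M" "M \<subseteq> B"
  shows "M \<subseteq> subalgebra hull (G \<inter> M)"
proof
  fix b assume b: "b \<in> M"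
  then have "witness b (wit b)"
    using M(2) by (intro witness_wit) auto
  then have "b \<in> subalgebra hull (wit b)" "wit b \<subseteq> G \<inter> M"
    using elementary_wit[OF M(1) b] by (auto simp: witness_def)
  then show "b \<in> subalgebra hull (G \<inter> M)"
    using hull_mono[of "wit b" "G \<inter> M" subalgebra] by blast
qed

text \<open>The closure condition alone holds for the empty set, so \<open>bot\<close> is added to
  the starting set.\<close>

lemma elementary_hull_subset:
  "elementary hull X \<subseteq> (\<lambda>M. \<forall>x\<in>M. \<forall>y\<in>M. step x y \<subseteq> M) hull (insert bot X)"
  (is "_ \<subseteq> ?Q hull _")
proof (rule hull_minimal)
  have "insert bot X \<subseteq> ?Q hull (insert bot X)"
    by (rule hull_subset)
  moreover have "?Q (?Q hull (insert bot X))"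
    by (rule hull_in) blast
  ultimately show "X \<subseteq> ?Q hull (insert bot X)" "elementary (?Q hull (insert bot X))"
    by (auto simp: elementary_def)
qed

lemma elementary_hull_small:
  assumes "|X| <o \<kappa>"
  shows "|elementary hull X| <o \<kappa>"
proof -
  have "|insert bot X| <o \<kappa>"
    using Un_small[OF finite_small[of "{bot}"] assms] by simp
  then have "|(\<lambda>M. \<forall>x\<in>M. \<forall>y\<in>M. step x y \<subseteq> M) hull (insert bot X)| <o \<kappa>"
    by (intro card_of_closure_small[OF uncountable stable] step_small) (simp_all add: step_def)
  then show ?thesis
    by (rule subset_small[OF _ elementary_hull_subset])
qed

text \<open>If \<open>X\<close> is smaller than \<open>\<kappa>\<close>, so is its closure.
  Otherwise the closure has size at most \<open>|X|\<close>, because each step adds fewer than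
  \<open>\<kappa>\<close> elements.\<close>

lemma elementary_hull_less:
  fixes M :: "'a set"
  assumes M: "\<kappa> \<le>o |M|" and X: "|X| <o |M|"
  shows "|elementary hull X| <o |M|"
proof (cases "|X| <o \<kappa>")
  case True
  then show ?thesis
    using elementary_hull_small M ordLess_ordLeq_trans by blast
next
  case False
  then have large: "\<kappa> \<le>o |X|"
    using small_or_large by blast
  have "natLeq \<le>o |X|"
    using ordLess_imp_ordLeq[OF uncountable] large by (rule ordLeq_transitive)
  then have inf: "infinite X"
    using infinite_iff_natLeq_ordLeq by blast
  then have X': "|insert bot X| =o |X|"
    using infinite_imp_bij_betw2[OF inf, of bot] card_of_ordIso ordIso_symmetric
    by (metis Un_insert_right sup_bot_right)
  have "|step x y| \<le>o |insert bot X|" for x y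
    using ordLess_imp_ordLeq[OF step_small] large ordIso_symmetric[OF X']
      ordLeq_transitive ordLeq_ordIso_trans by blast
  then have "|(\<lambda>M. \<forall>x\<in>M. \<forall>y\<in>M. step x y \<subseteq> M) hull (insert bot X)| \<le>o |insert bot X|"
    using inf by (intro card_of_closure_large) (auto simp: step_def)
  then have "|elementary hull X| \<le>o |insert bot X|"
    using card_of_mono1[OF elementary_hull_subset] ordLeq_transitive by blast
  then show ?thesis
    using X' X ordLeq_ordIso_trans ordLeq_ordLess_trans by blast
qed

section \<open>Retractions onto elementary subsets\<close>

text \<open>This is the dual retraction on points. The set \<open>X\<close> collects what follows,
  at all points supported in \<open>M\<close>, from a single element of \<open>x \<inter> M\<close>.
  It omits \<open>bot\<close> because every nonzero element of \<open>M\<close> lies in a point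
  supported in its witness, hence in \<open>M\<close>.\<close>

lemma retract_point:
  assumes M: "elementary M" "M \<subseteq> B" and x: "ultrafilter B x"
  shows "\<exists>w. ultrafilter B w \<and> G \<inter> w \<subseteq> M \<and> w \<inter> M = x \<inter> M"
proof -
  define X where "X = {y \<in> B. \<exists>b \<in> x \<inter> M. \<forall>u. ultrafilter B u \<longrightarrow> G \<inter> u \<subseteq> M \<longrightarrow> b \<in> u \<longrightarrow> y \<in> u}"
  have xM: "x \<inter> M \<subseteq> X"
    using M(2) by (auto simp: X_def)
  have top: "top \<in> x \<inter> M"
    using ultrafilter_top[OF x] subalgebra_top[OF elementary_subalgebra[OF M(1)]] by simp
  have "\<exists>w. ultrafilter B w \<and> X \<subseteq> w"
  proof (rule ultrafilter_extend[OF subalgebra_B])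
    show "X \<noteq> {}"
      using xM top by blast
    show "bot \<notin> X"
    proof
      assume "bot \<in> X"
      then obtain b where b: "b \<in> x" "b \<in> M"
        and *: "\<And>u. ultrafilter B u \<Longrightarrow> G \<inter> u \<subseteq> M \<Longrightarrow> b \<in> u \<Longrightarrow> bot \<in> u"
        by (auto simp: X_def)
      have "b \<noteq> bot"
        using b(1) ultrafilter_bot[OF x] by auto
      then obtain u where "ultrafilter B u" "b \<in> u" "G \<inter> u \<subseteq> wit b"
        using witness_wit[of b] b(2) M(2) unfolding witness_def by blast
      then show False
        using *[of u] elementary_wit[OF M(1) b(2)] ultrafilter_bot[of B u] by blast
    qed
    show "inf y z \<in> X" if yz: "y \<in> X" "z \<in> X" for y z
    proof -
      obtain b where b: "b \<in> x \<inter> M"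
        "\<And>u. ultrafilter B u \<Longrightarrow> G \<inter> u \<subseteq> M \<Longrightarrow> b \<in> u \<Longrightarrow> y \<in> u"
        using yz(1) unfolding X_def by blast
      obtain c where c: "c \<in> x \<inter> M"
        "\<And>u. ultrafilter B u \<Longrightarrow> G \<inter> u \<subseteq> M \<Longrightarrow> c \<in> u \<Longrightarrow> z \<in> u"
        using yz(2) unfolding X_def by blast
      have "inf b c \<in> x \<inter> M"
        using b(1) c(1) ultrafilter_infI[OF x] subalgebra_inf[OF elementary_subalgebra[OF M(1)]]
        by blast
      moreover have "inf y z \<in> u" if u: "ultrafilter B u" "G \<inter> u \<subseteq> M" "inf b c \<in> u" for u
      proof -
        have "b \<in> u" "c \<in> u"
          using u(3) ultrafilter_inf_iff[OF u(1), of b c] b(1) c(1) M(2) by blast+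
        then show ?thesis
          using b(2) c(2) u by (intro ultrafilter_infI[OF u(1)]) auto
      qed
      moreover have "inf y z \<in> B"
        using yz subalgebra_inf[OF subalgebra_B] by (auto simp: X_def)
      ultimately show ?thesis
        unfolding X_def by blast
    qed
  qed (auto simp: X_def)
  then obtain w where w: "ultrafilter B w" and X: "X \<subseteq> w"
    by blast
  \<comment> \<open>The complement of a generator outside \<open>M\<close> belongs to every point
    supported in \<open>M\<close>, so it is in \<open>X\<close> with \<open>top\<close> as the
    element of \<open>x \<inter> M\<close>.\<close>
  have "g \<in> M" if g: "g \<in> G" "g \<in> w" for g
  proof (rule ccontr)
    assume "g \<notin> M"
    have gB: "g \<in> B"
      using g G_subset_B by blast
    have "- g \<in> u" if "ultrafilter B u" "G \<inter> u \<subseteq> M" for u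
      using that g \<open>g \<notin> M\<close> ultrafilter_uminus_iff[OF subalgebra_B that(1) gB] by blast
    then have "- g \<in> X"
      using subalgebra_uminus[OF subalgebra_B gB] top unfolding X_def by blast
    then show False
      using X g(2) ultrafilter_uminus_iff[OF subalgebra_B w gB] by blast
  qed
  moreover have "b \<in> x" if b: "b \<in> w" "b \<in> M" for b
  proof (rule ccontr)
    have bB: "b \<in> B"
      using b M(2) by blast
    assume "b \<notin> x"
    then have "- b \<in> x \<inter> M"
      using ultrafilter_uminus_iff[OF subalgebra_B x bB] b(2)
        subalgebra_uminus[OF elementary_subalgebra[OF M(1)]] by blast
    then show False
      using xM X b(1) ultrafilter_uminus_iff[OF subalgebra_B w bB] by blast
  qed
  ultimately show ?thesis
    using w xM X by blast
qed

text \<open>Were \<open>b\<close> outside \<open>A\<close>, two points with support in \<open>M\<close> and the same trace on \<open>A\<close> would be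
  separated by \<open>b\<close>, hence by \<open>a\<close>.\<close>

lemma retract_element:
  assumes M: "elementary M" "M \<subseteq> B" and a: "a \<in> A"
  shows "\<exists>b \<in> A \<inter> M. \<forall>w. ultrafilter B w \<longrightarrow> G \<inter> w \<subseteq> M \<longrightarrow> (a \<in> w \<longleftrightarrow> b \<in> w)"
proof -
  let ?R = "\<lambda>a b. \<forall>w. ultrafilter B w \<longrightarrow> G \<inter> w \<subseteq> M \<longrightarrow> (a \<in> w \<longleftrightarrow> b \<in> w)"
  note sM = elementary_subalgebra[OF M(1)]
  have "a \<in> subalgebra hull G"
    using a A_subset_B hull_G by blast
  then have "a \<in> B \<and> (\<exists>b\<in>M. ?R a b)"
  proof (rule hull_induct)
    show "g \<in> B \<and> (\<exists>b\<in>M. ?R g b)" if "g \<in> G" for g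
    proof (cases "g \<in> M")
      case True
      then show ?thesis
        using that G_subset_B by blast
    next
      case False
      \<comment> \<open>A generator outside \<open>M\<close> belongs to no point supported in
        \<open>M\<close>, so it is sent to \<open>bot\<close>.\<close>
      then have "?R g bot"
        using that ultrafilter_bot by blast
      then show ?thesis
        using that G_subset_B subalgebra_bot[OF sM] by blast
    qed
    show "subalgebra {a. a \<in> B \<and> (\<exists>b\<in>M. ?R a b)}"
    proof (rule subalgebraI)
      show "bot \<in> {a. a \<in> B \<and> (\<exists>b\<in>M. ?R a b)}"
        using subalgebra_bot[OF sM] subalgebra_bot[OF subalgebra_B] by blast
      show "- c \<in> {a. a \<in> B \<and> (\<exists>b\<in>M. ?R a b)}" if "c \<in> {a. a \<in> B \<and> (\<exists>b\<in>M. ?R a b)}" for c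
      proof -
        obtain b where b: "c \<in> B" "b \<in> M" "?R c b"
          using \<open>c \<in> _\<close> by blast
        then have "?R (- c) (- b)"
          using M(2) ultrafilter_uminus_iff[OF subalgebra_B] by blast
        then show ?thesis
          using b subalgebra_uminus[OF sM] subalgebra_uminus[OF subalgebra_B] by blast
      qed
      show "inf c d \<in> {a. a \<in> B \<and> (\<exists>b\<in>M. ?R a b)}"
        if cd: "c \<in> {a. a \<in> B \<and> (\<exists>b\<in>M. ?R a b)}" "d \<in> {a. a \<in> B \<and> (\<exists>b\<in>M. ?R a b)}" for c d
      proof -
        obtain b b' where b: "c \<in> B" "b \<in> M" "?R c b" "d \<in> B" "b' \<in> M" "?R d b'"
          using cd by blast
        then have "b \<in> B" "b' \<in> B"
          using M(2) by auto
        then have "?R (inf c d) (inf b b')"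
          using b by (simp add: ultrafilter_inf_iff)
        then show ?thesis
          using b subalgebra_inf[OF sM] subalgebra_inf[OF subalgebra_B] by blast
      qed
    qed
  qed
  then obtain b where b: "b \<in> M" "?R a b"
    by blast
  have "b \<in> A"
  proof (rule ccontr)
    assume "b \<notin> A"
    moreover have "b \<in> B"
      using b(1) M(2) by blast
    ultimately obtain w w' where w: "ultrafilter B w" "ultrafilter B w'" "w \<inter> A = w' \<inter> A"
      "b \<in> w" "b \<notin> w'" "G \<inter> w \<subseteq> wit b" "G \<inter> w' \<subseteq> wit b"
      using witness_wit[of b] unfolding witness_def by blast
    then have "G \<inter> w \<subseteq> M" "G \<inter> w' \<subseteq> M"
      using elementary_wit[OF M(1) b(1)] by auto
    then have "a \<in> w" "a \<notin> w'"
      using b(2) w by auto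
    then show False
      using w(3) a by blast
  qed
  then show ?thesis
    using b by blast
qed

section \<open>Small generating sets by induction on the cardinality\<close>

text \<open>Continuity of the chain: the hulls of initial segments are comparable, so their union is
  elementary. The hull of \<open>{}\<close> accounts for the least \<open>g\<close>, which has no
  predecessors.\<close>

lemma elementary_hull_underS_subset:
  assumes "Well_order r"
  shows "elementary hull (underS r g) \<subseteq>
    elementary hull {} \<union> (\<Union>g'\<in>underS r g. elementary hull (under r g'))"
proof (rule hull_minimal)
  let ?\<C> = "insert (elementary hull {}) ((\<lambda>g'. elementary hull (under r g')) ` underS r g)"
  have lin: "trans r" "refl_on (Field r) r" "total_on (Field r) r"
    using assms unfolding well_order_on_def linear_order_on_def partial_order_on_def
      preorder_on_def by auto
  have "under r a \<subseteq> under r b \<or> under r b \<subseteq> under r a" if "a \<in> Field r" "b \<in> Field r" for a b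
  proof -
    have "a = b \<or> (a, b) \<in> r \<or> (b, a) \<in> r"
      using that lin(3) by (auto simp: total_on_def)
    then show ?thesis
      using transD[OF lin(1)] by (auto simp: under_def)
  qed
  then have comparable: "elementary hull (under r a) \<subseteq> elementary hull (under r b) \<or>
      elementary hull (under r b) \<subseteq> elementary hull (under r a)" if "a \<in> underS r g" "b \<in> underS r g" for a b
    using that hull_mono underS_Field[of a r g] underS_Field[of b r g] by metis
  have "elementary hull {} \<subseteq> elementary hull (under r g')" for g'
    by (rule hull_mono) simp
  then have "M \<subseteq> N \<or> N \<subseteq> M" if "M \<in> ?\<C>" "N \<in> ?\<C>" for M N
  proof -
    have "N \<in> ?\<C> \<Longrightarrow> elementary hull {} \<subseteq> N" for N
      using that(1,2) \<open>\<And>g'. elementary hull {} \<subseteq> elementary hull (under r g')\<close> by auto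
    then show ?thesis
      using that comparable by (elim insertE imageE) simp_all
  qed
  then have "elementary (\<Union>?\<C>)"
    by (intro elementary_Union_chain) (auto simp: elementary_hull)
  then show "elementary (elementary hull {} \<union> (\<Union>g'\<in>underS r g. elementary hull (under r g')))"
    by simp
  show "underS r g \<subseteq> elementary hull {} \<union> (\<Union>g'\<in>underS r g. elementary hull (under r g'))"
  proof
    fix a assume a: "a \<in> underS r g"
    then have "a \<in> under r a"
      using refl_onD[OF lin(2)] underS_Field[of a r g] by (auto simp: under_def)
    then show "a \<in> elementary hull {} \<union> (\<Union>g'\<in>underS r g. elementary hull (under r g'))"
      using a hull_inc by fast
  qed
qed

text \<open>Smallness is required at all points of \<open>B\<close>, so that the induction
  hypothesis applies to a point and to its retracts alike.\<close>

lemma elementary_Corson: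
  "elementary M \<Longrightarrow> M \<subseteq> B \<Longrightarrow> \<exists>H \<subseteq> A \<inter> M. A \<inter> M \<subseteq> subalgebra hull H \<and>
     (\<forall>x. ultrafilter B x \<longrightarrow> |H \<inter> x| <o \<kappa>)"
proof (induction M rule: wf_induct_rule[OF wf_inv_image[OF wf_ordLess, of card_of]])
  case (1 M)
  note M = \<open>elementary M\<close> \<open>M \<subseteq> B\<close>
  show ?case
  proof (cases "|M| <o \<kappa>")
    case True
    have "|A \<inter> M \<inter> x| <o \<kappa>" for x
      by (rule subset_small[OF True]) blast
    then show ?thesis
      using hull_subset[of "A \<inter> M" subalgebra] by blast
  next
    case False
    then have large: "\<kappa> \<le>o |M|"
      using small_or_large by blast
    have "natLeq \<le>o |M|"
      using ordLess_imp_ordLeq[OF uncountable] large by (rule ordLeq_transitive)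
    then have inf: "infinite M"
      using infinite_iff_natLeq_ordLeq by blast
    \<comment> \<open>The cardinal \<open>|M|\<close> is a well-order of \<open>M\<close> whose
      proper initial segments are smaller than \<open>M\<close>; it indexes the chain.\<close>
    define r where "r = |M|"
    have wo: "Well_order r" and Field: "Field r = M" and co: "Card_order r"
      unfolding r_def by (rule card_of_Well_order Field_card_of card_of_Card_order)+
    have lin: "trans r" "antisym r" "refl_on M r" "total_on M r" "wf (r - Id)"
      using wo Field unfolding well_order_on_def linear_order_on_def partial_order_on_def
        preorder_on_def by auto
    \<comment> \<open>Here \<open>lo g\<close> and \<open>hi g\<close> are consecutive members of
      the chain, before and after \<open>g\<close> is added.\<close>
    define lo hi where "lo g = elementary hull (underS r g)" and "hi g = elementary hull (under r g)" for g
    have el: "elementary (lo g)" "elementary (hi g)" for g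
      by (simp_all add: lo_def hi_def elementary_hull)
    have sub: "lo g \<subseteq> M" "hi g \<subseteq> M" for g
    proof -
      have "underS r g \<subseteq> M" "under r g \<subseteq> M"
        unfolding Field[symmetric] by (auto simp: underS_def under_def intro: FieldI1)
      then show "lo g \<subseteq> M" "hi g \<subseteq> M"
        using M(1) by (simp_all add: lo_def hi_def hull_minimal)
    qed
    have hi_lo: "hi g \<subseteq> lo g'" if "(g, g') \<in> r" "g \<noteq> g'" for g g'
      unfolding lo_def hi_def
    proof (rule hull_mono, rule subsetI)
      fix a assume "a \<in> under r g"
      then have a: "(a, g) \<in> r"
        by (simp add: under_def)
      then have "(a, g') \<in> r"
        using that(1) by (rule transD[OF lin(1)])
      moreover have "a \<noteq> g'"
        using a that antisymD[OF lin(2)] by blast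
      ultimately show "a \<in> underS r g'"
        by (simp add: underS_def)
    qed
    have hi_card: "|hi g| <o |M|" if "g \<in> M" for g
    proof -
      have "under r g \<subseteq> underS r g \<union> {g}"
        by (auto simp: underS_def under_def)
      moreover have "|underS r g \<union> {g}| <o |M|"
      proof (rule card_of_Un_ordLess_infinite[OF inf])
        show "|underS r g| <o |M|"
          using card_of_underS[OF co] that Field by (simp add: r_def)
        show "|{g}| <o |M|"
          by (rule ordLess_ordLeq_trans[OF finite_small large]) simp
      qed
      ultimately have "|under r g| <o |M|"
        using card_of_mono1 ordLeq_ordLess_trans by blast
      then show ?thesis
        unfolding hi_def by (rule elementary_hull_less[OF large])
    qed
    have "\<exists>H \<subseteq> A \<inter> hi g. A \<inter> hi g \<subseteq> subalgebra hull H \<and>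
        (\<forall>x. ultrafilter B x \<longrightarrow> |H \<inter> x| <o \<kappa>)" if "g \<in> M" for g
    proof (rule "1.IH")
      show "(hi g, M) \<in> inv_image ordLess card_of"
        using hi_card[OF that] by simp
    qed (use el(2) sub(2)[of g] M(2) in auto)
    then obtain H where H: "\<And>g. g \<in> M \<Longrightarrow> H g \<subseteq> A \<inter> hi g"
      "\<And>g. g \<in> M \<Longrightarrow> A \<inter> hi g \<subseteq> subalgebra hull (H g)"
      "\<And>g x. g \<in> M \<Longrightarrow> ultrafilter B x \<Longrightarrow> |H g \<inter> x| <o \<kappa>"
      by metis
    \<comment> \<open>The map \<open>e g\<close> retracts \<open>A\<close> onto
      \<open>A \<inter> lo g\<close>.\<close>
    define e where "e g a = (SOME b. b \<in> A \<inter> lo g \<and>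
      (\<forall>w. ultrafilter B w \<longrightarrow> G \<inter> w \<subseteq> lo g \<longrightarrow> (a \<in> w \<longleftrightarrow> b \<in> w)))" for g a
    have e: "e g a \<in> A \<inter> lo g"
      "\<And>w. ultrafilter B w \<Longrightarrow> G \<inter> w \<subseteq> lo g \<Longrightarrow> a \<in> w \<longleftrightarrow> e g a \<in> w" if "a \<in> A" for a g
    proof -
      have "lo g \<subseteq> B"
        using sub(1) M(2) by (rule subset_trans)
      then have "\<exists>b. b \<in> A \<inter> lo g \<and>
          (\<forall>w. ultrafilter B w \<longrightarrow> G \<inter> w \<subseteq> lo g \<longrightarrow> (a \<in> w \<longleftrightarrow> b \<in> w))"
        using retract_element[OF el(1) _ that] by (simp add: Bex_def)
      from someI_ex[OF this] show "e g a \<in> A \<inter> lo g"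
        "\<And>w. ultrafilter B w \<Longrightarrow> G \<inter> w \<subseteq> lo g \<Longrightarrow> a \<in> w \<longleftrightarrow> e g a \<in> w"
        unfolding e_def by blast+
    qed
    define piece where "piece g = (\<Union>h\<in>H g. {inf h (- e g h), inf (e g h) (- h)})" for g
    \<comment> \<open>The bottom of the chain is small, so its part in \<open>A\<close> is taken
      whole.\<close>
    define K where "K = A \<inter> elementary hull {} \<union> (\<Union>g\<in>M. piece g)"
    have "K \<subseteq> A \<inter> M"
    proof
      fix k assume "k \<in> K"
      then consider "k \<in> A \<inter> elementary hull {}"
        | g h where "g \<in> M" "h \<in> H g" "k = inf h (- e g h) \<or> k = inf (e g h) (- h)"
        by (auto simp: K_def piece_def)
      then show "k \<in> A \<inter> M"
      proof cases
        case 1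
        then show ?thesis
          using hull_minimal[of "{}" M elementary] M(1) by blast
      next
        case 2
        have "h \<in> A" "h \<in> M" "e g h \<in> A" "e g h \<in> M"
          using 2 H(1)[of g] e(1)[of h g] sub[of g] by auto
        moreover have "inf h (- e g h) \<in> N \<and> inf (e g h) (- h) \<in> N"
          if "subalgebra N" "h \<in> N" "e g h \<in> N" for N
          using that by (simp add: subalgebra_inf subalgebra_uminus)
        ultimately show ?thesis
          using 2(3) subalgebra_A elementary_subalgebra[OF M(1)] by blast
      qed
    qed
    \<comment> \<open>By continuity, \<open>A \<inter> lo g\<close> is generated by the base and the
      earlier stages. Each \<open>h \<in> H g\<close> is then recovered from its retract and the two
      differences.\<close>
    moreover have hi_K: "g \<in> M \<longrightarrow> A \<inter> hi g \<subseteq> subalgebra hull K" for g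
    proof (induction g rule: wf_induct_rule[OF lin(5)])
      case (1 g)
      show ?case
      proof
        assume g: "g \<in> M"
        have "A \<inter> lo g \<subseteq> subalgebra hull K"
        proof
          fix a assume a: "a \<in> A \<inter> lo g"
          then consider "a \<in> elementary hull {}" | g' where "g' \<in> underS r g" "a \<in> hi g'"
            using elementary_hull_underS_subset[OF wo, of g] unfolding lo_def hi_def by blast
          then show "a \<in> subalgebra hull K"
          proof cases
            case 1
            then show ?thesis
              using a by (intro hull_inc) (simp add: K_def)
          next
            case 2
            then have "(g', g) \<in> r - Id" "g' \<in> M"
              unfolding Field[symmetric] by (auto simp: underS_def intro: FieldI1)
            then show ?thesis
              using "1.IH" 2(2) a by blast
          qed
        qed
        moreover have "h \<in> subalgebra hull K" if h: "h \<in> H g" "e g h \<in> subalgebra hull K" for h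
        proof -
          have pieces: "inf h (- e g h) \<in> subalgebra hull K" "inf (e g h) (- h) \<in> subalgebra hull K"
            using h(1) g by (auto intro!: hull_inc simp: K_def piece_def)
          note hull = subalgebra_hull[of K]
          \<comment> \<open>In terms of sets, \<open>h\<close> is the union of \<open>h - e\<close>
            and \<open>e - (e - h)\<close>, where \<open>e\<close> is its retract.\<close>
          have "sup (inf h (- e g h)) (inf (e g h) (- inf (e g h) (- h))) \<in> subalgebra hull K"
            by (rule subalgebra_sup[OF hull pieces(1)
                subalgebra_inf[OF hull h(2) subalgebra_uminus[OF hull pieces(2)]]])
          moreover have "inf (e g h) (- inf (e g h) (- h)) = inf h (e g h)"
            by (simp add: inf_sup_distrib1 inf_commute)
          then have "sup (inf h (- e g h)) (inf (e g h) (- inf (e g h) (- h))) = h"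
            by (simp flip: inf_sup_distrib1)
          ultimately show ?thesis
            by simp
        qed
        ultimately have "H g \<subseteq> subalgebra hull K"
          using H(1)[OF g] e(1) by blast
        then have "subalgebra hull (H g) \<subseteq> subalgebra hull K"
          by (intro hull_minimal subalgebra_hull)
        then show "A \<inter> hi g \<subseteq> subalgebra hull K"
          using H(2)[OF g] by blast
      qed
    qed
    have "A \<inter> M \<subseteq> subalgebra hull K"
    proof
      fix a assume a: "a \<in> A \<inter> M"
      then have "a \<in> under r a"
        using refl_onD[OF lin(3)] by (auto simp: under_def)
      then have "a \<in> hi a"
        unfolding hi_def by (rule hull_inc)
      then show "a \<in> subalgebra hull K"
        using hi_K[of a] a by blast
    qed
    moreover have "|K \<inter> x| <o \<kappa>" if x: "ultrafilter B x" for x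
    proof -
      have "\<exists>w. ultrafilter B w \<and> G \<inter> w \<subseteq> lo g \<and> w \<inter> lo g = x \<inter> lo g" for g
        using retract_point[OF el(1) _ x] sub(1)[of g] M(2) by blast
      then obtain w where w: "\<And>g. ultrafilter B (w g)" "\<And>g. G \<inter> w g \<subseteq> lo g"
        "\<And>g. w g \<inter> lo g = x \<inter> lo g"
        by metis
      \<comment> \<open>The retract lies in \<open>lo g\<close>, where \<open>x\<close> and
        \<open>w g\<close> have the same trace, and it agrees with \<open>h\<close> at
        \<open>w g\<close>.\<close>
      have ew: "e g h \<in> x \<longleftrightarrow> h \<in> w g" if "g \<in> M" "h \<in> H g" for g h
        using e(1)[of h g] e(2)[of h "w g" g] w[of g] H(1)[of g] that by blast
      have HB: "h \<in> B" "e g h \<in> B" if "g \<in> M" "h \<in> H g" for g h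
        using H(1)[of g] e(1)[of h g] A_subset_B that by blast+
      have piece_x: "inf h (- e g h) \<in> x \<longleftrightarrow> h \<in> x \<and> h \<notin> w g"
        "inf (e g h) (- h) \<in> x \<longleftrightarrow> h \<in> w g \<and> h \<notin> x" if "g \<in> M" "h \<in> H g" for g h
        using HB[OF that] ew[OF that] x
        by (simp_all add: ultrafilter_inf_iff ultrafilter_uminus_iff[OF subalgebra_B]
            subalgebra_uminus[OF subalgebra_B])
      \<comment> \<open>The induction hypothesis is used at both \<open>x\<close> and
        \<open>w g\<close>, once for each direction of the difference.\<close>
      have piece_small: "|piece g \<inter> x| <o \<kappa>" if g: "g \<in> M" for g
      proof (rule subset_small)
        show "|(\<lambda>h. inf h (- e g h)) ` (H g \<inter> x) \<union> (\<lambda>h. inf (e g h) (- h)) ` (H g \<inter> w g)| <o \<kappa>"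
          by (intro Un_small image_small H(3) g x w)
        show "piece g \<inter> x \<subseteq> (\<lambda>h. inf h (- e g h)) ` (H g \<inter> x) \<union> (\<lambda>h. inf (e g h) (- h)) ` (H g \<inter> w g)"
          using piece_x[OF g] by (auto simp: piece_def)
      qed
      define I where "I = {g \<in> M. piece g \<inter> x \<noteq> {}}"
      \<comment> \<open>A difference at stage \<open>g\<close> means that \<open>x\<close> and
        \<open>w g\<close> disagree on some \<open>h \<in> hi g\<close>, hence on a generator in
        \<open>hi g\<close>. They agree on \<open>lo g\<close>, and \<open>w g\<close> has no
        generator outside it, so this generator is in \<open>x\<close> and not in
        \<open>lo g\<close>.\<close>
      have "\<exists>k. k \<in> G \<inter> x \<and> k \<in> hi g \<and> k \<notin> lo g" if g: "g \<in> I" for g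
      proof (rule ccontr)
        assume neg: "\<nexists>k. k \<in> G \<inter> x \<and> k \<in> hi g \<and> k \<notin> lo g"
        have gM: "g \<in> M"
          using g by (simp add: I_def)
        have agree: "k \<in> x \<longleftrightarrow> k \<in> w g" if "k \<in> G \<inter> hi g" for k
          using that neg w(2,3)[of g] by blast
        obtain h where h: "h \<in> H g" "h \<in> x \<longleftrightarrow> h \<notin> w g"
          using g piece_x[OF gM] by (auto simp: I_def piece_def)
        have "h \<in> hi g"
          using H(1)[OF gM] h(1) by blast
        then have "h \<in> subalgebra hull (G \<inter> hi g)"
          using elementary_generated[OF el(2), of g] sub(2)[of g] M(2) by blast
        moreover have "G \<inter> hi g \<subseteq> B"
          using G_subset_B by blast
        ultimately have "h \<in> x \<longleftrightarrow> h \<in> w g"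
          using ultrafilters_agree_hull[OF subalgebra_B x w(1)] agree by blast
        then show False
          using h(2) by blast
      qed
      then obtain k where k: "\<And>g. g \<in> I \<Longrightarrow> k g \<in> G \<inter> x \<and> k g \<in> hi g \<and> k g \<notin> lo g"
        by metis
      \<comment> \<open>The layers between \<open>lo g\<close> and \<open>hi g\<close> are pairwise
        disjoint.\<close>
      have "inj_on k I"
      proof (rule inj_onI, rule ccontr)
        fix g g' assume g: "g \<in> I" "g' \<in> I" "k g = k g'" "g \<noteq> g'"
        then have "(g, g') \<in> r \<or> (g', g) \<in> r"
          using lin(4) by (auto simp: total_on_def I_def)
        then have "hi g \<subseteq> lo g' \<or> hi g' \<subseteq> lo g"
          using hi_lo g(4) by metis
        then show False
          using k[OF g(1)] k[OF g(2)] g(3) by auto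
      qed
      moreover have "k ` I \<subseteq> G \<inter> x"
        using k by blast
      ultimately have "|I| \<le>o |G \<inter> x|"
        using card_of_ordLeq by blast
      then have "|I| <o \<kappa>"
        using point_small[OF x] by (rule ordLeq_ordLess_trans)
      \<comment> \<open>Regularity once more: fewer than \<open>\<kappa>\<close> stages contribute,
        each with fewer than \<open>\<kappa>\<close> elements.\<close>
      then have "|\<Union>g\<in>I. piece g \<inter> x| <o \<kappa>"
        by (rule stable_UNION[OF stable]) (simp add: I_def piece_small)
      then have "|elementary hull {} \<union> (\<Union>g\<in>I. piece g \<inter> x)| <o \<kappa>"
        by (rule Un_small[OF elementary_hull_small[OF finite_small[OF finite.emptyI]]])
      then show ?thesis
        by (rule subset_small) (auto simp: K_def I_def)
    qed
    ultimately show ?thesis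
      by blast
  qed
qed

end

section \<open>From points of \<open>B\<close> to ultrafilters of \<open>A\<close>\<close>

theorem theorem3p5:
  fixes \<kappa> :: "'k rel" and A B :: "'a::boolean_algebra set"
  assumes "Card_order \<kappa>" and "natLeq <o \<kappa>" and "regularCard \<kappa>"
    and "Corson \<kappa> B"
    and "subalgebra A" and "A \<subseteq> B"
  shows "Corson \<kappa> A"
proof -
  obtain G where B: "subalgebra B" and G: "G \<subseteq> B" "subalgebra hull G = B"
    "\<And>p. ultrafilter B p \<Longrightarrow> |G \<inter> p| <o \<kappa>"
    using assms(4) by (auto simp: Corson_def)
  interpret corson_subalgebra \<kappa> A B G
    using assms B G by unfold_locales
  obtain H where H: "H \<subseteq> A" "A \<subseteq> subalgebra hull H" "\<And>x. ultrafilter B x \<Longrightarrow> |H \<inter> x| <o \<kappa>"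
    using elementary_Corson[OF elementary_B] assms(6) by (auto simp: Int_absorb2)
  have "subalgebra hull H = A"
    using H(1,2) assms(5) by (intro equalityI hull_minimal)
  \<comment> \<open>Every ultrafilter of \<open>A\<close> is the trace of a point of
    \<open>B\<close>: extend it with \<open>top\<close> as the additional element.\<close>
  moreover have "|H \<inter> p| <o \<kappa>" if p: "ultrafilter A p" for p
  proof -
    have "inf a top \<noteq> bot" if "a \<in> p" for a
      using that ultrafilter_bot[OF p] by auto
    then obtain x where x: "ultrafilter B x" "x \<inter> A = p"
      using ultrafilter_over[OF assms(5) B assms(6) p subalgebra_top[OF B]] by blast
    then show ?thesis
      by (intro subset_small[OF H(3)[OF x(1)]]) auto
  qed
  ultimately show ?thesis
    using assms(5) H(1) by (auto simp: Corson_def)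
qed

end
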